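(* Let $A\subset[-\pi,\pi]$ be nonempty and let $\theta\in C_0^\infty(\mathbb{R})$ be a nonnegative function such that $\theta(x)>0$ for $x\in A$ and $\operatorname{supp}\theta\subseteq[-\pi,\pi]$. For $k\in\mathbb{Z}$ let $\phi_k$ be defined by $\widehat{\phi}_k(\xi)=\theta(\xi+k\pi)$, $\xi\in\mathbb{R}$. Let $i\in\mathbb{Z}$, $r\in\mathbb{N}$ and $\Phi=(\phi_i,\phi_{i+1},\dots,\phi_{i+r})^T$. Then the rank of the matrix $[\widehat{\Phi}(\xi+2j\pi)]_{j\in\mathbb{Z}}$ is not a constant function of $\xi\in\mathbb{R}$.
   Context: $\widehat{\phi}(\xi)=\int_{\mathbb{R}}\phi(x)e^{-\mathrm{i}x\xi}\,dx$ denotes the Fourier transform. $\mathbb{N}=\{1,2,\dots\}$. $[\widehat{\Phi}(\xi+2j\pi)]_{j\in\mathbb{Z}}$ denotes the $(r+1)\times\infty$ matrix with columns indexed by $j\in\mathbb{Z}$ and rows indexed by $m=i,\dots,i+r$, whose $(m,j)$ entry is $\widehat{\phi}_m(\xi+2j\pi)$. *)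

theory Defs
  imports "HOL-Analysis.Analysis" "HOL-Library.Function_Algebras"
begin

(* The Bochner integral is 0 when the integrand is not integrable. Since the modulus of the
   integrand is that of f, the transform of a non-integrable f is identically 0; so if it takes
   a nonzero value anywhere, f is integrable and the integral is the genuine one. *)
definition fourier :: "(real \<Rightarrow> complex) \<Rightarrow> real \<Rightarrow> complex" where
  "fourier f \<xi> =
     integral\<^sup>L lebesgue (\<lambda>x. f x * exp (- (\<i> * complex_of_real x * complex_of_real \<xi>)))"

definition smooth_compact_support :: "(real \<Rightarrow> real) set" where
  "smooth_compact_support =
     {f. (\<forall>n x. ((deriv ^^ n) f) field_differentiable (at x)) \<and>
         compact (closure (support_on UNIV f))}"

abbreviation row_scale :: "complex \<Rightarrow> ('n \<Rightarrow> complex) \<Rightarrow> 'n \<Rightarrow> complex" where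
  "row_scale c v \<equiv> (\<lambda>j. c * v j)"

lemma vector_space_row_scale: "vector_space row_scale"
  by unfold_locales (auto simp: fun_eq_iff algebra_simps)

(* A matrix with rows indexed by I and (possibly infinitely many) columns indexed by the type 'n
   is given by its entries M m j, m in I. As for the library's rank of finite matrices, the rank
   is the dimension of the row space; it is meant for finite I. *)
definition rows_rank :: "'m set \<Rightarrow> ('m \<Rightarrow> 'n \<Rightarrow> complex) \<Rightarrow> nat" where
  "rows_rank I M = vector_space.dim row_scale (M ` I)"

definition shift_matrix :: "(int \<Rightarrow> real \<Rightarrow> complex) \<Rightarrow> real \<Rightarrow> int \<Rightarrow> int \<Rightarrow> complex" where
  "shift_matrix \<phi> \<xi> = (\<lambda>m j. fourier (\<phi> m) (\<xi> + 2 * of_int j * pi))"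

end

(* Replacing xi by eta - i pi reduces to i = 0. For eta in [0, pi] each row of the matrix then has
   at most one nonzero entry: theta(eta) for the rows of even index, theta(eta - pi) for those of
   odd index. So the rank is the number of columns that are hit. If the rank is constant, comparing
   eta = 0 with eta = pi shows that r is odd, and then the rank at 0 is attained at eta only if
   exactly one of theta(eta), theta(eta - pi) is nonzero. The two open sets where they are nonzero
   would split the interval [0, pi]. *)

theory Submission
  imports Defs
begin

interpretation row_space: vector_space row_scale
  by (rule vector_space_row_scale)

lemma row_sum_apply: "(\<Sum>v\<in>T. f v) j = (\<Sum>v\<in>T. f v j)"
  for f :: "'a \<Rightarrow> 'n \<Rightarrow> complex"
  by (induction T rule: infinite_finite_induct) auto

definition unit_row :: "'n \<Rightarrow> 'n \<Rightarrow> complex" where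
  "unit_row a = (\<lambda>j. if j = a then 1 else 0)"

lemma inj_unit_row: "inj unit_row"
  by (rule injI) (metis unit_row_def zero_neq_one)

text \<open>Evaluating a vanishing combination at the coordinate \<open>a\<close> isolates the
  coefficient of \<open>unit_row a\<close>.\<close>

lemma independent_unit_rows:
  assumes "finite J"
  shows "row_space.independent (unit_row ` J)"
proof (rule row_space.independent_if_scalars_zero)
  show "finite (unit_row ` J)" using assms by simp
  fix f v
  assume sum0: "(\<Sum>v\<in>unit_row ` J. row_scale (f v) v) = 0" and "v \<in> unit_row ` J"
  then obtain a where a: "a \<in> J" "v = unit_row a" by blast
  have "0 = (\<Sum>v\<in>unit_row ` J. row_scale (f v) v) a"
    using sum0 by simp
  also have "\<dots> = (\<Sum>v\<in>unit_row ` J. f v * v a)"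
    by (rule row_sum_apply)
  also have "\<dots> = (\<Sum>b\<in>J. f (unit_row b) * unit_row b a)"
    using inj_unit_row by (subst sum.reindex) (auto intro: inj_on_subset)
  also have "\<dots> = (\<Sum>b\<in>J. if a = b then f (unit_row b) else 0)"
    by (rule sum.cong) (auto simp: unit_row_def)
  also have "\<dots> = f v"
    using a assms by simp
  finally show "f v = 0" by simp
qed

text \<open>Row \<open>m\<close> is \<open>c m\<close> times the unit row at \<open>p m\<close>, so
  the row space is spanned by the independent unit rows at the columns that carry a nonzero entry.
  Several rows may share a column, hence the cardinality of an image.\<close>

lemma rows_rank_single_entries:
  assumes "finite I"
    and M: "\<And>m j. m \<in> I \<Longrightarrow> M m j = (if j = p m then c m else 0)"
  shows "rows_rank I M = card (p ` {m \<in> I. c m \<noteq> 0})"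
proof -
  let ?J = "p ` {m \<in> I. c m \<noteq> 0}"
  have row: "M m = row_scale (c m) (unit_row (p m))" if "m \<in> I" for m
    using M[OF that] by (auto simp: unit_row_def fun_eq_iff)
  have "M m \<in> row_space.span (unit_row ` ?J)" if "m \<in> I" for m
  proof (cases "c m = 0")
    case True
    then have "M m = 0" using M[OF that] by (auto simp: fun_eq_iff)
    then show ?thesis by (simp add: row_space.span_zero)
  next
    case False
    then have "unit_row (p m) \<in> unit_row ` ?J" using that by blast
    then show ?thesis
      unfolding row[OF that] by (intro row_space.span_scale row_space.span_base)
  qed
  moreover have "unit_row (p m) \<in> row_space.span (M ` I)" if "m \<in> I" "c m \<noteq> 0" for m
  proof -
    have "unit_row (p m) = row_scale (inverse (c m)) (M m)"
      using that by (auto simp: row[OF that(1)] fun_eq_iff)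
    then show ?thesis
      using that by (metis imageI row_space.span_base row_space.span_scale)
  qed
  ultimately have "row_space.span (M ` I) = row_space.span (unit_row ` ?J)"
    unfolding row_space.span_eq by auto
  then have "row_space.dim (M ` I) = row_space.dim (unit_row ` ?J)"
    by (rule row_space.span_eq_dim)
  also have "\<dots> = card (unit_row ` ?J)"
    using assms(1) by (intro row_space.dim_eq_card_independent independent_unit_rows) simp
  also have "\<dots> = card ?J"
    using inj_unit_row by (intro card_image) (auto intro: inj_on_subset)
  finally show ?thesis unfolding rows_rank_def .
qed

lemma smooth_compact_support_continuous:
  assumes "f \<in> smooth_compact_support"
  shows "continuous_on UNIV f"
proof -
  have "((deriv ^^ 0) f) field_differentiable (at x)" for x
    using assms unfolding smooth_compact_support_def by blast
  then show ?thesis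
    by (simp add: continuous_at_imp_continuous_on field_differentiable_imp_continuous_at)
qed

text \<open>By continuity the nonzero set is open, so it lies in the interior of the interval. The
  gain is the vanishing at the two endpoints.\<close>

lemma zero_outside_open_support_interval:
  fixes f :: "real \<Rightarrow> real"
  assumes cont: "continuous_on UNIV f"
    and supp: "closure (support_on UNIV f) \<subseteq> {a..b}"
    and x: "x \<notin> {a<..<b}"
  shows "f x = 0"
proof (rule ccontr)
  assume "f x \<noteq> 0"
  have "open {y. f y \<noteq> 0}"
    using cont by (intro open_Collect_neq) auto
  moreover have "{y. f y \<noteq> 0} \<subseteq> {a..b}"
    using supp closure_subset[of "support_on UNIV f"] by (auto simp: support_on_def)
  ultimately have "{y. f y \<noteq> 0} \<subseteq> {a<..<b}"
    by (metis interior_atLeastAtMost_real interior_maximal)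
  with x \<open>f x \<noteq> 0\<close> show False by blast
qed

text \<open>If m - i = 2k, the rounding gives the column -k, and k runs from 0 to r div 2.\<close>

lemma image_even_rows:
  "(\<lambda>m. - ((m - i + 1) div 2)) ` {m \<in> {i..i + int r}. even (m - i)} = {- (int r div 2)..0}"
  (is "?p ` ?S = ?T")
proof
  show "?p ` ?S \<subseteq> ?T"
  proof
    fix j assume "j \<in> ?p ` ?S"
    then obtain m where m: "j = ?p m" "m \<ge> i" "m \<le> i + int r" "even (m - i)" by auto
    from m(4) obtain k where "m - i = 2 * k" by (rule evenE)
    then show "j \<in> ?T" using m by simp
  qed
  show "?T \<subseteq> ?p ` ?S"
  proof
    fix j assume "j \<in> ?T"
    then show "j \<in> ?p ` ?S" by (intro image_eqI[where x = "i - 2 * j"]) auto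
  qed
qed

text \<open>If m - i = 2k + 1, the column is -(k + 1): the range starts at -1, and its left end is
  governed by r + 1 instead of r.\<close>

lemma image_odd_rows:
  "(\<lambda>m. - ((m - i + 1) div 2)) ` {m \<in> {i..i + int r}. odd (m - i)} = {- ((int r + 1) div 2)..-1}"
  (is "?p ` ?S = ?T")
proof
  show "?p ` ?S \<subseteq> ?T"
  proof
    fix j assume "j \<in> ?p ` ?S"
    then obtain m where m: "j = ?p m" "m \<ge> i" "m \<le> i + int r" "odd (m - i)" by auto
    from m(4) obtain k where "m - i = 2 * k + 1" by (rule oddE)
    then show "j \<in> ?T" using m by simp
  qed
  show "?T \<subseteq> ?p ` ?S"
  proof
    fix j assume "j \<in> ?T"
    then show "j \<in> ?p ` ?S" by (intro image_eqI[where x = "i - 2 * j - 1"]) auto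
  qed
qed

text \<open>The entries of a row are values of \<open>\<theta>\<close> at points spaced 2 pi apart,
  and the open interval (-pi, pi) contains at most one of them. The two sets are the columns hit by
  the rows with m - i even and odd.\<close>

lemma rows_rank_shift_matrix:
  fixes \<theta> :: "real \<Rightarrow> real" and \<phi> :: "int \<Rightarrow> real \<Rightarrow> complex"
  assumes zero: "\<And>x. x \<notin> {-pi<..<pi} \<Longrightarrow> \<theta> x = 0"
    and fourier_\<phi>: "\<And>k \<xi>. fourier (\<phi> k) \<xi> = complex_of_real (\<theta> (\<xi> + of_int k * pi))"
    and \<eta>: "0 \<le> \<eta>" "\<eta> \<le> pi"
  shows "rows_rank {i..i + int r} (shift_matrix \<phi> (\<eta> - of_int i * pi)) =
    card ((if \<theta> \<eta> \<noteq> 0 then {- (int r div 2)..0} else {}) \<union>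
          (if \<theta> (\<eta> - pi) \<noteq> 0 then {- ((int r + 1) div 2)..-1} else {}))"
proof -
  \<comment> \<open>Column \<open>p m\<close> brings the argument of row \<open>m\<close> to
    \<open>b m\<close>. Adding 1 before halving rounds up, so odd rows land at
    \<open>\<eta> - pi\<close> and not at \<open>\<eta> + pi\<close>; thus \<open>b m\<close> stays
    in [-pi, pi].\<close>
  define p :: "int \<Rightarrow> int" where "p m = - ((m - i + 1) div 2)" for m
  define b where "b m = (if even (m - i) then \<eta> else \<eta> - pi)" for m
  have entry: "shift_matrix \<phi> (\<eta> - of_int i * pi) m j =
    (if j = p m then complex_of_real (\<theta> (b m)) else 0)" for m j
  proof -
    have "m = i - 2 * p m - (if even (m - i) then 0 else 1)"
    proof (cases "even (m - i)")
      case True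
      then obtain k where "m - i = 2 * k" by (rule evenE)
      then show ?thesis using True by (simp add: p_def)
    next
      case False
      then obtain k where "m - i = 2 * k + 1" by (rule oddE)
      then show ?thesis using False by (simp add: p_def)
    qed
    then have m: "real_of_int m = real_of_int i - 2 * real_of_int (p m) -
        (if even (m - i) then 0 else 1)"
      by (auto split: if_splits)
    have arg: "\<eta> - of_int i * pi + 2 * of_int j * pi + of_int m * pi =
        b m + of_int (j - p m) * (2 * pi)"
      unfolding b_def by (subst m) (simp add: algebra_simps)
    \<comment> \<open>A nonzero multiple of 2 pi moves a point of [-pi, pi] out of the open
      interval; at best it carries one endpoint to the other.\<close>
    have "\<theta> (b m + of_int (j - p m) * (2 * pi)) = 0" if neq: "j \<noteq> p m"
    proof (rule zero)
      have b: "- pi \<le> b m" "b m \<le> pi" using \<eta> unfolding b_def by auto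
      consider "j - p m \<ge> 1" | "j - p m \<le> -1" using neq by linarith
      then show "b m + of_int (j - p m) * (2 * pi) \<notin> {-pi<..<pi}"
      proof cases
        case 1
        then have "real_of_int (j - p m) \<ge> 1" by linarith
        then have "1 * (2 * pi) \<le> of_int (j - p m) * (2 * pi)"
          by (intro mult_right_mono) simp_all
        then show ?thesis using b unfolding greaterThanLessThan_iff by linarith
      next
        case 2
        then have "real_of_int (j - p m) \<le> -1" by linarith
        then have "of_int (j - p m) * (2 * pi) \<le> (-1) * (2 * pi)"
          by (intro mult_right_mono) simp_all
        then show ?thesis using b unfolding greaterThanLessThan_iff by linarith
      qed
    qed
    then show ?thesis
      unfolding shift_matrix_def fourier_\<phi> arg by auto
  qed
  have "rows_rank {i..i + int r} (shift_matrix \<phi> (\<eta> - of_int i * pi)) =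
      card (p ` {m \<in> {i..i + int r}. complex_of_real (\<theta> (b m)) \<noteq> 0})"
    by (rule rows_rank_single_entries) (simp_all add: entry)
  also have "{m \<in> {i..i + int r}. complex_of_real (\<theta> (b m)) \<noteq> 0} =
      (if \<theta> \<eta> \<noteq> 0 then {m \<in> {i..i + int r}. even (m - i)} else {}) \<union>
      (if \<theta> (\<eta> - pi) \<noteq> 0 then {m \<in> {i..i + int r}. odd (m - i)} else {})"
    unfolding b_def by auto
  also have "p ` \<dots> =
      (if \<theta> \<eta> \<noteq> 0 then {- (int r div 2)..0} else {}) \<union>
      (if \<theta> (\<eta> - pi) \<noteq> 0 then {- ((int r + 1) div 2)..-1} else {})"
    using image_even_rows[of i r] image_odd_rows[of i r]
    unfolding p_def[abs_def] image_Un by (simp only: if_distrib[of "image _"] image_empty)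
  finally show ?thesis .
qed

theorem mainTheorem6:
  fixes A :: "real set" and \<theta> :: "real \<Rightarrow> real" and \<phi> :: "int \<Rightarrow> real \<Rightarrow> complex"
    and i :: int and r :: nat
  assumes "A \<subseteq> {-pi..pi}" and "A \<noteq> {}"
    and "\<theta> \<in> smooth_compact_support"
    and "\<And>x. \<theta> x \<ge> 0"
    and "\<And>x. x \<in> A \<Longrightarrow> \<theta> x > 0"
    and "closure (support_on UNIV \<theta>) \<subseteq> {-pi..pi}"
    and "\<And>k \<xi>. fourier (\<phi> k) \<xi> = complex_of_real (\<theta> (\<xi> + of_int k * pi))"
    and "r \<ge> 1"
  shows "\<not> (\<lambda>\<xi>::real. rows_rank {i..i + int r} (shift_matrix \<phi> \<xi>)) constant_on UNIV"
proof
  assume "(\<lambda>\<xi>::real. rows_rank {i..i + int r} (shift_matrix \<phi> \<xi>)) constant_on UNIV"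
  then obtain n where n: "\<And>\<xi>. rows_rank {i..i + int r} (shift_matrix \<phi> \<xi>) = n"
    unfolding constant_on_def by auto
  have cont: "continuous_on UNIV \<theta>"
    using assms(3) by (rule smooth_compact_support_continuous)
  have zero: "\<theta> x = 0" if "x \<notin> {-pi<..<pi}" for x
    using cont assms(6) that by (rule zero_outside_open_support_interval)
  have rank: "n = card ((if \<theta> \<eta> \<noteq> 0 then {- (int r div 2)..0} else {}) \<union>
      (if \<theta> (\<eta> - pi) \<noteq> 0 then {- ((int r + 1) div 2)..-1} else {}))"
    if "0 \<le> \<eta>" "\<eta> \<le> pi" for \<eta>
    using rows_rank_shift_matrix[OF zero assms(7) that, of i r] n by simp
  \<comment> \<open>These values silence the odd rows at \<open>\<eta> = 0\<close> and the even rows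
    at \<open>\<eta> = pi\<close>.\<close>
  have \<theta>_pi: "\<theta> pi = 0" "\<theta> (- pi) = 0"
    by (simp_all add: zero)
  have "\<theta> 0 \<noteq> 0"
  proof
    assume "\<theta> 0 = 0"
    then have "n = 0" using rank[of 0] \<theta>_pi by simp
    \<comment> \<open>Rank 0 forces both column sets to be empty. The odd range is nonempty because
      r is at least 1, so both values of \<open>\<theta>\<close> must vanish.\<close>
    have none: "\<theta> \<eta> = 0 \<and> \<theta> (\<eta> - pi) = 0" if "0 \<le> \<eta>" "\<eta> \<le> pi" for \<eta>
      using rank[OF that] \<open>n = 0\<close> assms(8) by (auto split: if_splits)
    obtain a where a: "a \<in> A" using assms(2) by blast
    then have "- pi \<le> a" "a \<le> pi" "\<theta> a > 0" using assms(1,5) by auto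
    \<comment> \<open>The points \<open>\<eta>\<close> and \<open>\<eta> - pi\<close> together sweep
      out [-pi, pi], which contains \<open>a\<close>.\<close>
    then show False using none[of a] none[of "a + pi"] by (cases "a \<ge> 0") auto
  qed
  have even_count: "n = nat (int r div 2 + 1)"
    using rank[of 0] \<theta>_pi \<open>\<theta> 0 \<noteq> 0\<close> by simp
  moreover have odd_count: "n = nat ((int r + 1) div 2)"
    using rank[of pi] \<theta>_pi \<open>\<theta> 0 \<noteq> 0\<close> by simp
  \<comment> \<open>This equation says that r is odd.\<close>
  ultimately have half: "(int r + 1) div 2 = int r div 2 + 1"
    by linarith
  have split: "(\<theta> \<eta> \<noteq> 0) \<noteq> (\<theta> (\<eta> - pi) \<noteq> 0)" if "0 \<le> \<eta>" "\<eta> \<le> pi" for \<eta>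
  proof
    assume eq: "(\<theta> \<eta> \<noteq> 0) = (\<theta> (\<eta> - pi) \<noteq> 0)"
    show False
    proof (cases "\<theta> \<eta> = 0")
      case True
      \<comment> \<open>Both values vanish, so the rank would be 0, whereas n is at least 1.\<close>
      then show False using rank[OF that] eq even_count by simp
    next
      case False
      \<comment> \<open>By \<open>half\<close> the odd range reaches one column further left than
        the even one, so the union has r div 2 + 2 = n + 1 columns.\<close>
      have "{- (int r div 2)..0} \<union> {- ((int r + 1) div 2)..-1} = {- (int r div 2) - 1..0}"
        using half by auto
      then have "n = card {- (int r div 2) - 1..0}"
        using rank[OF that] eq False by simp
      then show False using even_count by simp
    qed
  qed
  have "continuous_on UNIV (\<lambda>x. \<theta> (x - pi))"
    by (rule continuous_on_compose2[OF cont]) (auto intro: continuous_on_diff)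
  with cont have "open {x. \<theta> x \<noteq> 0}" "open {x. \<theta> (x - pi) \<noteq> 0}"
    by (simp_all add: open_Collect_neq)
  moreover have "{x. \<theta> x \<noteq> 0} \<inter> {x. \<theta> (x - pi) \<noteq> 0} \<inter> {0..pi} = {}"
    and "{0..pi} \<subseteq> {x. \<theta> x \<noteq> 0} \<union> {x. \<theta> (x - pi) \<noteq> 0}"
    using split by auto
  ultimately have "{x. \<theta> x \<noteq> 0} \<inter> {0..pi} = {} \<or> {x. \<theta> (x - pi) \<noteq> 0} \<inter> {0..pi} = {}"
    by (intro connectedD[OF connected_Icc])
  \<comment> \<open>Both open sets meet [0, pi]: at pi the second condition reads
    \<open>\<theta> 0 \<noteq> 0\<close>.\<close>
  moreover have "0 \<in> {x. \<theta> x \<noteq> 0} \<inter> {0..pi}" "pi \<in> {x. \<theta> (x - pi) \<noteq> 0} \<inter> {0..pi}"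
    using \<open>\<theta> 0 \<noteq> 0\<close> by auto
  ultimately show False by blast
qed

end
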